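(* Let $c_*>0$ be any constant. (a) For 3-Majority started from any initial configuration, with high probability there exists $T=O(\sqrt n(\log n)^2)$ such that $\gamma_T\ge c_*\log n/\sqrt n$. (b) For 2-Choices started from any initial configuration, with high probability there exists $T=O(n(\log n)^3)$ such that $\gamma_T\ge c_*(\log n)^2/n$.
   Context: **Setting.** Let $V$ be a set of $n$ vertices and $k\in\{1,\dots,n\}$. A configuration is a map $\mathsf{opn}\colon V\to[k]$. The process is synchronous: each round $t\ge1$ produces $\mathsf{opn}_t$ from $\mathsf{opn}_{t-1}$, and all vertices make their choices independently. **3-Majority.** Each vertex $v$ samples $w_1,w_2,w_3\in V$ independently and uniformly, with replacement. It sets $\mathsf{opn}_t(v)=\mathsf{opn}_{t-1}(w_1)$ if $\mathsf{opn}_{t-1}(w_1)=\mathsf{opn}_{t-1}(w_2)$, and $\mathsf{opn}_t(v)=\mathsf{opn}_{t-1}(w_3)$ otherwise. **2-Choices.** Each vertex $v$ samples $w_1,w_2\in V$ independently and uniformly, with replacement. It sets $\mathsf{opn}_t(v)=\mathsf{opn}_{t-1}(w_1)$ if $\mathsf{opn}_{t-1}(w_1)=\mathsf{opn}_{t-1}(w_2)$, and $\mathsf{opn}_t(v)=\mathsf{opn}_{t-1}(v)$ otherwise. **Basic quantities.** - $\alpha_t(i)=|\{v:\mathsf{opn}_t(v)=i\}|/n$. - $\gamma_t=\sum_{i\in[k]}\alpha_t(i)^2$. **Conventions.** "With high probability" means with probability $1-O(n^{-c})$ for some constant $c>0$. The $O(\cdot)$ constants may depend on $c_*$ only. *)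

theory Defs
  imports "HOL-Probability.Probability"
begin

text \<open>Vertices are 0..<n, opinions are 0..<k. A configuration is a function nat => nat
  (only its values on 0..<n matter).\<close>

definition unif_vertex :: "nat \<Rightarrow> nat pmf" where
  "unif_vertex n = pmf_of_set {..<n}"

definition three_majority_vertex :: "nat \<Rightarrow> (nat \<Rightarrow> nat) \<Rightarrow> nat \<Rightarrow> nat pmf" where
  "three_majority_vertex n opn v =
     do { w1 \<leftarrow> unif_vertex n; w2 \<leftarrow> unif_vertex n; w3 \<leftarrow> unif_vertex n;
          return_pmf (if opn w1 = opn w2 then opn w1 else opn w3) }"

definition two_choices_vertex :: "nat \<Rightarrow> (nat \<Rightarrow> nat) \<Rightarrow> nat \<Rightarrow> nat pmf" where
  "two_choices_vertex n opn v =
     do { w1 \<leftarrow> unif_vertex n; w2 \<leftarrow> unif_vertex n;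
          return_pmf (if opn w1 = opn w2 then opn w1 else opn v) }"

definition three_majority_step :: "nat \<Rightarrow> (nat \<Rightarrow> nat) \<Rightarrow> (nat \<Rightarrow> nat) pmf" where
  "three_majority_step n opn = Pi_pmf {..<n} 0 (three_majority_vertex n opn)"

definition two_choices_step :: "nat \<Rightarrow> (nat \<Rightarrow> nat) \<Rightarrow> (nat \<Rightarrow> nat) pmf" where
  "two_choices_step n opn = Pi_pmf {..<n} 0 (two_choices_vertex n opn)"

fun trajectory :: "('c \<Rightarrow> 'c pmf) \<Rightarrow> 'c \<Rightarrow> nat \<Rightarrow> 'c list pmf" where
  "trajectory step c0 0 = return_pmf [c0]"
| "trajectory step c0 (Suc m) =
     do { xs \<leftarrow> trajectory step c0 m; y \<leftarrow> step (last xs); return_pmf (xs @ [y]) }"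

definition alpha :: "nat \<Rightarrow> (nat \<Rightarrow> nat) \<Rightarrow> nat \<Rightarrow> real" where
  "alpha n opn i = real (card {v. v < n \<and> opn v = i}) / real n"

definition gamma :: "nat \<Rightarrow> nat \<Rightarrow> (nat \<Rightarrow> nat) \<Rightarrow> real" where
  "gamma n k opn = (\<Sum>i<k. (alpha n opn i)^2)"

end

theory Submission
  imports Defs "HOL-Real_Asymp.Real_Asymp"
begin

text \<open>
  For both processes the expected fraction of opinion \<open>i\<close> after one round is
  \<open>p i = \<alpha> i * (1 + \<alpha> i - \<gamma>)\<close>, and \<open>\<Sum>i. (p i)\<^sup>2 \<ge> \<gamma>\<close>, because \<open>\<Sum>i. \<alpha> i ^ 3 \<ge> \<gamma>\<^sup>2\<close>.
  Hence \<open>\<gamma>\<close> gains at least the total variance of the fractions in expectation: \<open>d = 1 / (2 * n)\<close>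
  for 3-Majority and \<open>\<gamma> / (2 * n) \<ge> d = 1 / (2 * n\<^sup>2)\<close> for 2-Choices, as long as \<open>\<gamma> \<le> 1 / 16\<close>.
  A Chernoff bound on the opinion counts shows that one round cannot lift \<open>\<gamma> < x\<close> above
  \<open>M = 32 * x + 32 * (ln n)\<^sup>2 / n\<close> except with probability \<open>n\<close> to the power \<open>-3\<close>.
  So \<open>min \<gamma> M\<close> is a bounded potential with drift \<open>d / 2\<close>, and from every configuration the level \<open>x\<close> is reached
  within about \<open>4 * M / d\<close> rounds with probability at least \<open>1 / 2\<close>. Repeating this about
  \<open>ln n\<close> times gives the claim.
\<close>

section \<open>Trajectories, avoidance probabilities and hitting under drift\<close>

lemma integrable_pmf_bounded:
  fixes f :: "'a \<Rightarrow> real"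
  assumes "\<And>x. \<bar>f x\<bar> \<le> B"
  shows "integrable (measure_pmf p) f"
  by (rule measure_pmf.integrable_const_bound[where B = B]) (use assms in auto)

lemma measure_bind_pmf:
  "measure_pmf.prob (bind_pmf p f) A = measure_pmf.expectation p (\<lambda>x. measure_pmf.prob (f x) A)"
  unfolding measure_pmf_bind
  by (rule measure_pmf.measure_bind[where N = "count_space UNIV"])
    (auto simp: measure_pmf_in_subprob_algebra)

lemma trajectory_nonempty: "xs \<in> set_pmf (trajectory step s m) \<Longrightarrow> xs \<noteq> []"
  by (cases m) auto

text \<open>\<open>trajectory\<close> grows at its end, whereas conditioning on the first round
  needs the split at its start; induction moves the appended step past the prepended state.\<close>

lemma trajectory_Suc_first_step:
  "trajectory step s (Suc m) = step s \<bind> (\<lambda>y. map_pmf ((#) s) (trajectory step y m))"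
proof (induction m)
  case 0
  show ?case
    by (simp add: bind_return_pmf map_pmf_def)
next
  case (Suc m)
  have "trajectory step s (Suc (Suc m)) =
      trajectory step s (Suc m) \<bind> (\<lambda>xs. step (last xs) \<bind> (\<lambda>y. return_pmf (xs @ [y])))"
    by simp
  also have "\<dots> = step s \<bind> (\<lambda>y. trajectory step y m \<bind>
      (\<lambda>xs. step (last (s # xs)) \<bind> (\<lambda>z. return_pmf ((s # xs) @ [z]))))"
    unfolding Suc.IH by (simp add: bind_assoc_pmf bind_map_pmf)
  also have "\<dots> = step s \<bind> (\<lambda>y. trajectory step y m \<bind>
      (\<lambda>xs. step (last xs) \<bind> (\<lambda>z. return_pmf (s # (xs @ [z])))))"
    by (intro bind_pmf_cong refl) (auto dest: trajectory_nonempty)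
  also have "\<dots> = step s \<bind> (\<lambda>y. map_pmf ((#) s) (trajectory step y (Suc m)))"
    by (simp add: map_bind_pmf)
  finally show ?case .
qed

text \<open>The recursion runs over the starting state, so that later inductions use one-step
  expectations only and no lists. The starting state counts as visited.\<close>

primrec avoidance :: "('c \<Rightarrow> 'c pmf) \<Rightarrow> 'c set \<Rightarrow> nat \<Rightarrow> 'c \<Rightarrow> real" where
  "avoidance step A 0 s = (if s \<in> A then 0 else 1)"
| "avoidance step A (Suc m) s =
     (if s \<in> A then 0 else measure_pmf.expectation (step s) (avoidance step A m))"

lemma prob_trajectory_avoids:
  "measure_pmf.prob (trajectory step s m) {xs. \<forall>x\<in>set xs. x \<notin> A} = avoidance step A m s"
proof (induction m arbitrary: s)
  case 0
  show ?case by (simp add: indicator_def)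
next
  case (Suc m)
  have "measure_pmf.prob (trajectory step s (Suc m)) {xs. \<forall>x\<in>set xs. x \<notin> A} =
     measure_pmf.expectation (step s)
       (\<lambda>y. measure_pmf.prob (trajectory step y m) (((#) s) -` {xs. \<forall>x\<in>set xs. x \<notin> A}))"
    unfolding trajectory_Suc_first_step
    by (simp add: measure_bind_pmf)
  also have "((#) s) -` {xs. \<forall>x\<in>set xs. x \<notin> A} =
     (if s \<in> A then {} else {xs. \<forall>x\<in>set xs. x \<notin> A})"
    by auto
  finally show ?case using Suc by simp
qed

lemma avoidance_bounds: "0 \<le> avoidance step A m s" "avoidance step A m s \<le> 1"
  unfolding prob_trajectory_avoids[symmetric] by auto

text \<open>Markov property: after \<open>m\<close> rounds the state still lies in the invariant set
  \<open>V\<close>, and from there the next \<open>l\<close> rounds avoid \<open>A\<close> with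
  probability at most \<open>q\<close>.\<close>

lemma avoidance_add_le:
  assumes "\<And>s y. s \<in> V \<Longrightarrow> y \<in> set_pmf (step s) \<Longrightarrow> y \<in> V"
    and "\<And>s. s \<in> V \<Longrightarrow> avoidance step A l s \<le> q" and "s \<in> V"
  shows "avoidance step A (m + l) s \<le> q * avoidance step A m s"
  using \<open>s \<in> V\<close>
proof (induction m arbitrary: s)
  case 0
  then show ?case using assms(2)[of s] by (cases l) auto
next
  case (Suc m)
  have int: "integrable (measure_pmf (step s)) (avoidance step A j)" for j
    by (rule integrable_pmf_bounded[where B = 1]) (simp add: avoidance_bounds)
  have "measure_pmf.expectation (step s) (avoidance step A (m + l))
      \<le> measure_pmf.expectation (step s) (\<lambda>y. q * avoidance step A m y)"
    by (rule integral_mono_AE)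
       (use int Suc assms(1) in \<open>auto simp: AE_measure_pmf_iff intro!: integrable_mult_right\<close>)
  then show ?case by simp
qed

text \<open>A potential below \<open>M\<close> that gains \<open>d\<close> per step in expectation can do so only for
  about \<open>M / d\<close> steps; the factor \<open>d / 2\<close> pays for truncating \<open>f\<close> at \<open>M\<close>.\<close>

lemma avoidance_le_of_drift:
  fixes f :: "'c \<Rightarrow> real"
  assumes inv: "\<And>s y. s \<in> V \<Longrightarrow> y \<in> set_pmf (step s) \<Longrightarrow> y \<in> V"
    and f01: "\<And>s. 0 \<le> f s" "\<And>s. f s \<le> 1"
    and drift: "\<And>s. s \<in> V \<Longrightarrow> f s < x \<Longrightarrow> f s + d \<le> measure_pmf.expectation (step s) f"
    and jump: "\<And>s. s \<in> V \<Longrightarrow> f s < x \<Longrightarrow> measure_pmf.prob (step s) {y. f y > M} \<le> d / 2"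
    and "d > 0" "M \<ge> 0" "s \<in> V"
  shows "real m * (d / 2) * avoidance step {s. f s \<ge> x} m s \<le> M - min (f s) M"
  using \<open>s \<in> V\<close>
proof (induction m arbitrary: s)
  case 0
  then show ?case by simp
next
  case (Suc m)
  let ?E = "measure_pmf.expectation (step s)" and ?u = "avoidance step {s. f s \<ge> x}"
  show ?case
  proof (cases "f s < x")
    case True
    have int: "integrable (measure_pmf (step s)) (?u j)" for j
      by (rule integrable_pmf_bounded[where B = 1]) (simp add: avoidance_bounds)
    have intf: "integrable (measure_pmf (step s)) f"
      by (rule integrable_pmf_bounded[where B = 1]) (simp add: f01)
    have intg: "integrable (measure_pmf (step s)) (\<lambda>y. min (f y) M)"
      by (rule integrable_pmf_bounded[where B = 1]) (use f01 \<open>M \<ge> 0\<close> in \<open>auto simp: abs_le_iff min_le_iff_disj intro: order_trans[of _ 0]\<close>)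
    have inti: "integrable (measure_pmf (step s)) (indicat_real {y. f y > M})"
      by (rule integrable_pmf_bounded[where B = 1]) (auto simp: indicator_def)
    have "f s + d \<le> ?E f" using drift Suc.prems True by blast
    \<comment> \<open>As \<open>f\<close> is at most 1 and \<open>M\<close> is nonnegative,
      truncation loses at most the indicator of exceeding \<open>M\<close>, hence at most
      \<open>d / 2\<close> in expectation.\<close>
    also have "\<dots> \<le> ?E (\<lambda>y. min (f y) M + indicat_real {y. f y > M} y)"
    proof (rule integral_mono)
      fix y
      show "f y \<le> min (f y) M + indicat_real {y. f y > M} y"
        using f01(2)[of y] \<open>M \<ge> 0\<close> by (auto simp: indicator_def)
    qed (use intf intg inti in auto)
    also have "\<dots> = ?E (\<lambda>y. min (f y) M) + measure_pmf.prob (step s) {y. f y > M}"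
      using intg inti by simp
    finally have gain: "f s + d / 2 \<le> ?E (\<lambda>y. min (f y) M)"
      using jump[OF Suc.prems True] by simp
    have "real m * (d / 2) * ?E (?u m) = ?E (\<lambda>y. real m * (d / 2) * ?u m y)" by simp
    also have "\<dots> \<le> ?E (\<lambda>y. M - min (f y) M)"
      by (rule integral_mono_AE)
         (use int intg Suc.IH inv Suc.prems in \<open>auto simp: AE_measure_pmf_iff\<close>)
    also have "\<dots> = M - ?E (\<lambda>y. min (f y) M)" using intg by simp
    finally have 1: "real m * (d / 2) * ?u (Suc m) s \<le> M - f s - d / 2"
      using gain True by simp
    \<comment> \<open>The current round contributes at most \<open>d / 2\<close> because
      \<open>avoidance\<close> is at most 1; the induction hypothesis has paid for the other
      \<open>m\<close> rounds.\<close>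
    have "(d / 2) * ?u (Suc m) s \<le> d / 2"
      using avoidance_bounds(2)[of step "{s. f s \<ge> x}" "Suc m" s] \<open>d > 0\<close>
      by (intro mult_left_le) auto
    then have "real (Suc m) * (d / 2) * ?u (Suc m) s \<le> M - f s"
      using 1 unfolding of_nat_Suc distrib_right by linarith
    then show ?thesis by linarith
  qed simp
qed

text \<open>The drift bound gives \<open>m * (d / 2) * avoidance \<le> M\<close>, and
  \<open>m > 4 * M / d\<close> turns this into avoidance at most 1/2 over a block of
  \<open>m\<close> rounds, from every state of \<open>V\<close>. The Markov property multiplies the
  bounds of \<open>j\<close> consecutive blocks.\<close>

lemma prob_trajectory_hits:
  fixes f :: "'c \<Rightarrow> real"
  assumes inv: "\<And>s y. s \<in> V \<Longrightarrow> y \<in> set_pmf (step s) \<Longrightarrow> y \<in> V"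
    and f01: "\<And>s. 0 \<le> f s" "\<And>s. f s \<le> 1"
    and drift: "\<And>s. s \<in> V \<Longrightarrow> f s < x \<Longrightarrow> f s + d \<le> measure_pmf.expectation (step s) f"
    and jump: "\<And>s. s \<in> V \<Longrightarrow> f s < x \<Longrightarrow> measure_pmf.prob (step s) {y. f y > M} \<le> d / 2"
    and d: "d > 0" and M: "M \<ge> 0" and s: "s \<in> V"
    and m: "4 * M / d < real m" and t: "j * m \<le> t"
  shows "measure_pmf.prob (trajectory step s t) {xs. \<exists>T<length xs. f (xs ! T) \<ge> x}
    \<ge> 1 - (1 / 2) ^ j"
proof -
  let ?u = "avoidance step {s. f s \<ge> x}"
  have half: "?u m s \<le> 1 / 2" if "s \<in> V" for s
  proof -
    have "0 \<le> 4 * M / d" using d M by simp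
    then have "real m > 0" using m by linarith
    then have md: "real m * (d / 2) > 0" using d by simp
    have "real m * (d / 2) * ?u m s \<le> M - min (f s) M"
      by (rule avoidance_le_of_drift[where V = V]) (use assms that in auto)
    also have "\<dots> \<le> real m * (d / 2) * (1 / 2)"
      using m d M f01(1)[of s] by (simp add: field_simps)
    finally show ?thesis using md by (simp only: mult_le_cancel_left_pos)
  qed
  have pow: "?u (i * m) s \<le> (1 / 2) ^ i" if "s \<in> V" for i s
    using that
  proof (induction i arbitrary: s)
    case 0
    then show ?case by (simp add: avoidance_bounds)
  next
    case (Suc i)
    have "?u (m + i * m) s \<le> (1 / 2) ^ i * ?u m s"
      by (rule avoidance_add_le[where V = V]) (use inv Suc in auto)
    also have "\<dots> \<le> (1 / 2) ^ i * (1 / 2)"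
      by (rule mult_left_mono) (use half Suc in auto)
    finally show ?case by simp
  qed
  \<comment> \<open>The rounds after the last full block cannot raise the avoidance probability:
    this is the case \<open>q = 1\<close>.\<close>
  have "?u t s = ?u (j * m + (t - j * m)) s" using t by simp
  also have "\<dots> \<le> 1 * ?u (j * m) s"
    by (rule avoidance_add_le[where V = V]) (use inv s in \<open>auto simp: avoidance_bounds\<close>)
  finally have "?u t s \<le> (1 / 2) ^ j" using pow[OF s, of j] by simp
  moreover have "{xs. \<exists>T<length xs. f (xs ! T) \<ge> x} =
      space (measure_pmf (trajectory step s t)) - {xs. \<forall>y\<in>set xs. y \<notin> {s. f s \<ge> x}}"
    by (auto simp: in_set_conv_nth) (metis nth_mem)
  ultimately show ?thesis
    by (simp only: measure_pmf.prob_compl prob_trajectory_avoids sets_measure_pmf UNIV_I)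
qed

section \<open>Second moments and tails of opinion counts\<close>

text \<open>The count is a sum of independent indicators: pairs of distinct vertices factor, and the
  diagonal adds the Bernoulli variances. The law \<open>q v\<close> may vary with the vertex, as
  2-Choices requires.\<close>

lemma expectation_count_square_Pi_pmf:
  fixes q :: "nat \<Rightarrow> nat pmf"
  shows "measure_pmf.expectation (Pi_pmf {..<n} dflt q) (\<lambda>y. (real (card {v. v < n \<and> y v = i}))\<^sup>2)
    = (\<Sum>v<n. pmf (q v) i)\<^sup>2 + (\<Sum>v<n. pmf (q v) i * (1 - pmf (q v) i))"
proof -
  let ?P = "Pi_pmf {..<n} dflt q"
  let ?I = "\<lambda>u v. {y :: nat \<Rightarrow> nat. y u = i \<and> y v = i}"
  have pair: "measure_pmf.prob ?P (?I u v) =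
      pmf (q u) i * pmf (q v) i + (if u = v then pmf (q u) i * (1 - pmf (q u) i) else 0)"
    if "u < n" "v < n" for u v
  proof -
    \<comment> \<open>One box covers both cases: for \<open>u = v\<close> the set
      \<open>{u, v}\<close> collapses and a single factor remains.\<close>
    let ?B = "\<lambda>w. if w = u \<or> w = v then {i} else UNIV"
    have "?I u v = Pi {..<n} ?B"
      using that by (auto simp: Pi_def)
    then have "measure_pmf.prob ?P (?I u v) = (\<Prod>w<n. measure_pmf.prob (q w) (?B w))"
      by (simp add: measure_Pi_pmf_Pi)
    also have "\<dots> = (\<Prod>w\<in>{u, v}. measure_pmf.prob (q w) (?B w))"
      using that by (intro prod.mono_neutral_right) auto
    also have "\<dots> = (\<Prod>w\<in>{u, v}. pmf (q w) i)"
      by (intro prod.cong) (auto simp: measure_pmf_single)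
    finally show ?thesis
      by (cases "u = v") (auto simp: algebra_simps)
  qed
  have card: "real (card {v. v < n \<and> y v = i}) = (\<Sum>v<n. indicat_real {y. y v = i} y)"
    for y :: "nat \<Rightarrow> nat"
  proof -
    have "{v. v < n \<and> y v = i} = {v \<in> {..<n}. y v = i}" by auto
    then show ?thesis by (simp add: indicator_def sum.If_cases Int_def)
  qed
  have "(real (card {v. v < n \<and> y v = i}))\<^sup>2 = (\<Sum>u<n. \<Sum>v<n. indicat_real (?I u v) y)"
    for y :: "nat \<Rightarrow> nat"
    unfolding card power2_eq_square sum_product
    by (intro sum.cong refl) (auto simp: indicator_def)
  then have "measure_pmf.expectation ?P (\<lambda>y. (real (card {v. v < n \<and> y v = i}))\<^sup>2)
      = (\<Sum>u<n. \<Sum>v<n. measure_pmf.prob ?P (?I u v))"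
    by (simp add: integrable_pmf_bounded[where B = 1] Bochner_Integration.integral_sum)
  also have "\<dots> = (\<Sum>u<n. \<Sum>v<n. pmf (q u) i * pmf (q v) i +
      (if u = v then pmf (q u) i * (1 - pmf (q u) i) else 0))"
    by (intro sum.cong refl pair) auto
  also have "\<dots> = (\<Sum>v<n. pmf (q v) i)\<^sup>2 + (\<Sum>v<n. pmf (q v) i * (1 - pmf (q v) i))"
    by (simp add: sum.distrib power2_eq_square sum_product)
  finally show ?thesis .
qed

text \<open>Chernoff bound with exponential parameter 1: each factor
  \<open>1 + (exp 1 - 1) * p\<close> is at most \<open>exp (2 * p)\<close> because e is at most 3,
  and Markov's inequality finishes.\<close>

lemma prob_count_ge_Pi_pmf:
  fixes q :: "nat \<Rightarrow> nat pmf"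
  assumes "(\<Sum>v<n. pmf (q v) i) \<le> \<mu>"
  shows "measure_pmf.prob (Pi_pmf {..<n} dflt q) {y. real (card {v. v < n \<and> y v = i}) \<ge> 2 * \<mu> + a}
    \<le> exp (- a)"
proof -
  let ?P = "Pi_pmf {..<n} dflt q"
  let ?g = "\<lambda>x. if x = i then exp 1 else (1 :: real)"
  have e: "exp (real (card {v. v < n \<and> y v = i})) = (\<Prod>v<n. ?g (y v))" for y :: "nat \<Rightarrow> nat"
  proof -
    have "(\<Prod>v<n. ?g (y v)) = exp 1 ^ card ({..<n} \<inter> {v. y v = i})"
      by (simp add: prod.If_cases)
    also have "{..<n} \<inter> {v. y v = i} = {v. v < n \<and> y v = i}" by auto
    finally show ?thesis by (simp flip: exp_of_nat_mult)
  qed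
  have intg: "integrable (measure_pmf p) ?g" for p :: "nat pmf"
    by (rule integrable_pmf_bounded[where B = "exp 1"]) auto
  have g: "measure_pmf.expectation p ?g = 1 + (exp 1 - 1) * pmf p i" for p :: "nat pmf"
  proof -
    have "?g = (\<lambda>x. 1 + (exp 1 - 1) * indicat_real {i} x)"
      by (auto simp: indicator_def)
    then show ?thesis
      by (simp add: integrable_pmf_bounded[where B = 1] measure_pmf_single)
  qed
  have "measure_pmf.expectation ?P (\<lambda>y. exp (real (card {v. v < n \<and> y v = i})))
      = (\<Prod>v<n. 1 + (exp 1 - 1) * pmf (q v) i)"
    unfolding e by (subst expectation_prod_Pi_pmf) (auto simp: intg g)
  also have "\<dots> \<le> (\<Prod>v<n. exp (2 * pmf (q v) i))"
  proof (intro prod_mono conjI)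
    fix v
    have "1 + (exp 1 - 1) * pmf (q v) i \<le> 1 + 2 * pmf (q v) i"
      using exp_le by (intro add_left_mono mult_right_mono) auto
    also have "\<dots> \<le> exp (2 * pmf (q v) i)" by (rule exp_ge_add_one_self)
    finally show "1 + (exp 1 - 1) * pmf (q v) i \<le> exp (2 * pmf (q v) i)" .
    show "0 \<le> 1 + (exp 1 - 1) * pmf (q v) i"
      by (intro add_nonneg_nonneg mult_nonneg_nonneg) auto
  qed
  also have "\<dots> = exp (2 * (\<Sum>v<n. pmf (q v) i))"
    by (simp add: exp_sum sum_distrib_left)
  also have "\<dots> \<le> exp (2 * \<mu>)" using assms by simp
  finally have mgf: "measure_pmf.expectation ?P (\<lambda>y. exp (real (card {v. v < n \<and> y v = i})))
    \<le> exp (2 * \<mu>)" .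
  have cardn: "card {v. v < n \<and> y v = i} \<le> n" for y :: "nat \<Rightarrow> nat"
    using card_mono[of "{..<n}" "{v. v < n \<and> y v = i}"] by auto
  have "measure_pmf.prob ?P {y. real (card {v. v < n \<and> y v = i}) \<ge> 2 * \<mu> + a}
     = measure_pmf.prob ?P {y \<in> space ?P. exp (real (card {v. v < n \<and> y v = i})) \<ge> exp (2 * \<mu> + a)}"
    by simp
  also have "\<dots> \<le> measure_pmf.expectation ?P (\<lambda>y. exp (real (card {v. v < n \<and> y v = i})))
      / exp (2 * \<mu> + a)"
    by (rule integral_Markov_inequality_measure[where A = "{}"])
       (auto intro!: integrable_pmf_bounded[where B = "exp (real n)"] simp: cardn)
  also have "\<dots> \<le> exp (2 * \<mu>) / exp (2 * \<mu> + a)"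
    using mgf by (intro divide_right_mono) auto
  also have "\<dots> = exp (- a)" by (simp flip: exp_diff)
  finally show ?thesis .
qed

section \<open>Opinion fractions and their sum of squares\<close>

lemma alpha_nonneg: "0 \<le> alpha n s i"
  by (simp add: alpha_def)

lemma gamma_nonneg: "0 \<le> gamma n k s"
  by (simp add: gamma_def sum_nonneg)

text \<open>The opinion classes are disjoint sets of vertices. The bound covers every configuration,
  including those with opinions outside \<open>{..<k}\<close>, so that \<open>gamma\<close> is at
  most 1 everywhere, as a potential in the drift argument must be.\<close>

lemma sum_alpha_le_1: "(\<Sum>i<k. alpha n s i) \<le> 1"
proof -
  have "(\<Sum>i<k. card {v. v < n \<and> s v = i}) = card (\<Union>i<k. {v. v < n \<and> s v = i})"
    by (rule card_UN_disjoint[symmetric]) auto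
  also have "\<dots> \<le> card {..<n}" by (rule card_mono) auto
  finally have "real (\<Sum>i<k. card {v. v < n \<and> s v = i}) \<le> real n"
    by (simp only: of_nat_le_iff card_lessThan)
  then show ?thesis
    by (cases "n = 0") (auto simp: alpha_def simp flip: sum_divide_distrib)
qed

lemma alpha_le_1: "alpha n s i \<le> 1"
proof -
  have "card {v. v < n \<and> s v = i} \<le> card {..<n}" by (rule card_mono) auto
  then show ?thesis by (cases "n = 0") (auto simp: alpha_def)
qed

lemma gamma_le_1: "gamma n k s \<le> 1"
proof -
  have "gamma n k s \<le> (\<Sum>i<k. alpha n s i)"
    unfolding gamma_def power2_eq_square
    by (intro sum_mono mult_left_le alpha_nonneg alpha_le_1)
  then show ?thesis using sum_alpha_le_1[of n s k] by simp
qed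

lemma alpha_square_le_gamma: "i < k \<Longrightarrow> (alpha n s i)\<^sup>2 \<le> gamma n k s"
  unfolding gamma_def by (rule member_le_sum) auto

lemma sum_over_vertices:
  assumes "\<forall>v<n. s v < k" "n > 0"
  shows "(\<Sum>v<n. h (s v)) = real n * (\<Sum>i<k. alpha n s i * h i)"
proof -
  have "(\<Sum>v<n. h (s v)) = (\<Sum>i<k. \<Sum>v\<in>{v\<in>{..<n}. s v = i}. h (s v))"
    by (rule sum.group[symmetric]) (use assms in auto)
  also have "\<dots> = (\<Sum>i<k. real n * (alpha n s i * h i))"
  proof (rule sum.cong[OF refl])
    fix i
    have "(\<Sum>v\<in>{v\<in>{..<n}. s v = i}. h (s v)) = (\<Sum>v\<in>{v\<in>{..<n}. s v = i}. h i)"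
      by (rule sum.cong) auto
    then show "(\<Sum>v\<in>{v\<in>{..<n}. s v = i}. h (s v)) = real n * (alpha n s i * h i)"
      using assms(2) by (simp add: alpha_def)
  qed
  finally show ?thesis by (simp add: sum_distrib_left)
qed

lemma sum_alpha_eq_1:
  assumes "\<forall>v<n. s v < k" "n > 0"
  shows "(\<Sum>i<k. alpha n s i) = 1"
  using sum_over_vertices[OF assms, where h = "\<lambda>_. 1"] assms(2) by simp

text \<open>Counts are integers, so each is at most its square. This turns the variance of
  2-Choices, proportional to \<open>gamma\<close>, into a drift independent of the
  configuration.\<close>

lemma gamma_ge_inverse:
  assumes "\<forall>v<n. s v < k" "n > 0"
  shows "1 / real n \<le> gamma n k s"
proof -
  have "alpha n s i / real n \<le> (alpha n s i)\<^sup>2" for i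
  proof -
    have "real c \<le> (real c)\<^sup>2" for c :: nat
      by (cases c) (auto simp: power2_eq_square)
    then show ?thesis
      using assms(2) by (simp add: alpha_def power_divide divide_right_mono power2_eq_square)
  qed
  then have "(\<Sum>i<k. alpha n s i / real n) \<le> gamma n k s"
    unfolding gamma_def by (rule sum_mono)
  then show ?thesis using sum_alpha_eq_1[OF assms] by (simp flip: sum_divide_distrib)
qed

text \<open>Draw opinion \<open>i\<close> with probability \<open>alpha n s i\<close>: the variance
  of its fraction is nonnegative, so the cubes sum to at least the square of \<open>gamma\<close>.
  In the expanded left-over square, \<open>(?a i * (?a i - ?g))\<^sup>2\<close> is dropped, and the
  cube bound cancels the rest.\<close>

lemma sum_mean_square_ge_gamma:
  assumes "\<forall>v<n. s v < k" "n > 0"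
  shows "gamma n k s \<le> (\<Sum>i<k. (alpha n s i * (1 + alpha n s i - gamma n k s))\<^sup>2)"
proof -
  let ?a = "alpha n s" and ?g = "gamma n k s"
  have g: "(\<Sum>i<k. ?a i * ?a i) = ?g" by (simp add: gamma_def power2_eq_square)
  have "0 \<le> (\<Sum>i<k. ?a i * (?a i - ?g)\<^sup>2)"
    by (intro sum_nonneg mult_nonneg_nonneg) (auto simp: alpha_nonneg)
  also have "\<dots> = (\<Sum>i<k. ?a i ^ 3 - 2 * ?g * (?a i * ?a i) + ?g\<^sup>2 * ?a i)"
    by (intro sum.cong) (auto simp: algebra_simps power2_eq_square power3_eq_cube)
  also have "\<dots> = (\<Sum>i<k. ?a i ^ 3) - 2 * ?g * ?g + ?g\<^sup>2"
    by (simp only: sum.distrib sum_subtractf g sum_alpha_eq_1[OF assms] flip: sum_distrib_left)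
  finally have cubes: "?g\<^sup>2 \<le> (\<Sum>i<k. ?a i ^ 3)" by (simp add: power2_eq_square)
  have "(\<Sum>i<k. ?a i * ?a i + 2 * ?a i ^ 3 - 2 * ?g * (?a i * ?a i))
      \<le> (\<Sum>i<k. (?a i * (1 + ?a i - ?g))\<^sup>2)"
  proof (rule sum_mono)
    fix i
    have "(?a i * (1 + ?a i - ?g))\<^sup>2 =
      (?a i * ?a i + 2 * ?a i ^ 3 - 2 * ?g * (?a i * ?a i)) + (?a i * (?a i - ?g))\<^sup>2"
      by (simp add: algebra_simps power2_eq_square power3_eq_cube)
    then show "?a i * ?a i + 2 * ?a i ^ 3 - 2 * ?g * (?a i * ?a i) \<le> (?a i * (1 + ?a i - ?g))\<^sup>2"
      by simp
  qed
  moreover have "(\<Sum>i<k. ?a i * ?a i + 2 * ?a i ^ 3 - 2 * ?g * (?a i * ?a i))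
      = ?g + 2 * (\<Sum>i<k. ?a i ^ 3) - 2 * ?g * ?g"
    by (simp only: sum.distrib sum_subtractf g flip: sum_distrib_left)
  ultimately show ?thesis using cubes by (simp add: power2_eq_square)
qed

text \<open>Squared means already sum to at least \<open>gamma\<close>, so any lower bounds
  \<open>e i\<close> on the count variances become gain. Both processes share the hypothesis on the
  means and differ only in \<open>e\<close>.\<close>

lemma expectation_gamma_Pi_pmf:
  fixes q :: "nat \<Rightarrow> nat pmf"
  assumes "\<forall>v<n. s v < k" "n > 0"
    and mean: "\<And>i. i < k \<Longrightarrow> (\<Sum>v<n. pmf (q v) i)
      = real n * (alpha n s i * (1 + alpha n s i - gamma n k s))"
    and var: "\<And>i. i < k \<Longrightarrow> e i \<le> (\<Sum>v<n. pmf (q v) i * (1 - pmf (q v) i))"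
  shows "gamma n k s + (\<Sum>i<k. e i) / (real n)\<^sup>2
    \<le> measure_pmf.expectation (Pi_pmf {..<n} dflt q) (gamma n k)"
proof -
  let ?P = "Pi_pmf {..<n} dflt q"
  have sq: "(alpha n s i * (1 + alpha n s i - gamma n k s))\<^sup>2 + e i / (real n)\<^sup>2
    \<le> measure_pmf.expectation ?P (\<lambda>y. (alpha n y i)\<^sup>2)" if "i < k" for i
  proof -
    have "measure_pmf.expectation ?P (\<lambda>y. (alpha n y i)\<^sup>2) =
      ((\<Sum>v<n. pmf (q v) i)\<^sup>2 + (\<Sum>v<n. pmf (q v) i * (1 - pmf (q v) i))) / (real n)\<^sup>2"
      unfolding alpha_def power_divide by (simp add: expectation_count_square_Pi_pmf)
    also have "\<dots> \<ge> ((\<Sum>v<n. pmf (q v) i)\<^sup>2 + e i) / (real n)\<^sup>2"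
      using var[OF that] by (intro divide_right_mono) auto
    finally show ?thesis
      using assms(2) mean[OF that] by (simp add: power_mult_distrib add_divide_distrib)
  qed
  have "gamma n k s + (\<Sum>i<k. e i) / (real n)\<^sup>2
    \<le> (\<Sum>i<k. (alpha n s i * (1 + alpha n s i - gamma n k s))\<^sup>2 + e i / (real n)\<^sup>2)"
    using sum_mean_square_ge_gamma[OF assms(1,2)] by (simp add: sum.distrib sum_divide_distrib)
  also have "\<dots> \<le> (\<Sum>i<k. measure_pmf.expectation ?P (\<lambda>y. (alpha n y i)\<^sup>2))"
    by (rule sum_mono) (use sq in auto)
  also have "\<dots> = measure_pmf.expectation ?P (gamma n k)"
    unfolding gamma_def
    by (subst Bochner_Integration.integral_sum)
       (auto intro!: integrable_pmf_bounded[where B = 1] simp: abs_square_le_1 alpha_nonneg alpha_le_1)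
  finally show ?thesis .
qed

text \<open>Each count has mean at most twice its current value. The tail at \<open>4 * ln n\<close>
  costs n to the power -4 per opinion, so a union bound over \<open>k \<le> n\<close> opinions
  leaves the power -3, eventually below half of either drift, even the order n to the power -2 of
  2-Choices.\<close>

lemma prob_gamma_jump_Pi_pmf:
  fixes q :: "nat \<Rightarrow> nat pmf"
  assumes "k \<le> n" "n > 0"
    and mean: "\<And>i. i < k \<Longrightarrow> (\<Sum>v<n. pmf (q v) i)
      = real n * (alpha n s i * (1 + alpha n s i - gamma n k s))"
  shows "measure_pmf.prob (Pi_pmf {..<n} dflt q)
      {y. gamma n k y > 32 * gamma n k s + 32 * (ln (real n))\<^sup>2 / real n} \<le> 1 / real n ^ 3"
proof -
  let ?P = "Pi_pmf {..<n} dflt q"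
  let ?B = "\<lambda>i. {y. real (card {v. v < n \<and> y v = i}) \<ge> 2 * (2 * real n * alpha n s i) + 4 * ln (real n)}"
  have B: "measure_pmf.prob ?P (?B i) \<le> 1 / real n ^ 4" if "i < k" for i
  proof -
    have "alpha n s i * (1 + alpha n s i - gamma n k s) \<le> alpha n s i * 2"
      using alpha_le_1[of n s i] gamma_nonneg[of n k s]
      by (intro mult_left_mono alpha_nonneg) auto
    then have "(\<Sum>v<n. pmf (q v) i) \<le> 2 * real n * alpha n s i"
      unfolding mean[OF that] using mult_left_mono[of _ _ "real n"] by fastforce
    then have "measure_pmf.prob ?P (?B i) \<le> exp (- (4 * ln (real n)))"
      by (rule prob_count_ge_Pi_pmf)
    also have "\<dots> = 1 / exp (ln (real n)) ^ 4"
      by (simp add: exp_minus field_simps flip: exp_of_nat_mult)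
    finally show ?thesis using assms(2) by simp
  qed
  have "{y. gamma n k y > 32 * gamma n k s + 32 * (ln (real n))\<^sup>2 / real n} \<subseteq> (\<Union>i<k. ?B i)"
  proof (rule subsetI, rule ccontr)
    fix y
    assume big: "y \<in> {y. gamma n k y > 32 * gamma n k s + 32 * (ln (real n))\<^sup>2 / real n}"
      and "y \<notin> (\<Union>i<k. ?B i)"
    then have small: "real (card {v. v < n \<and> y v = i}) < 4 * real n * alpha n s i + 4 * ln (real n)"
      if "i < k" for i using that by force
    have "(alpha n y i)\<^sup>2 \<le> 32 * (alpha n s i)\<^sup>2 + 32 * (ln (real n) / real n)\<^sup>2" if "i < k" for i
    proof -
      have "alpha n y i \<le> 4 * alpha n s i + 4 * (ln (real n) / real n)"
        unfolding alpha_def[of n y] using small[OF that] assms(2) by (simp add: field_simps)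
      then have "(alpha n y i)\<^sup>2 \<le> (4 * alpha n s i + 4 * (ln (real n) / real n))\<^sup>2"
        by (intro power_mono alpha_nonneg)
      \<comment> \<open>The identity (a + b)^2 = 2 a^2 + 2 b^2 - (a - b)^2, with both summands
        carrying a factor 4, is the source of 32.\<close>
      also have "\<dots> = 32 * (alpha n s i)\<^sup>2 + 32 * (ln (real n) / real n)\<^sup>2
          - (4 * alpha n s i - 4 * (ln (real n) / real n))\<^sup>2"
        by (simp add: power2_eq_square algebra_simps)
      also have "\<dots> \<le> 32 * (alpha n s i)\<^sup>2 + 32 * (ln (real n) / real n)\<^sup>2" by simp
      finally show ?thesis .
    qed
    then have "gamma n k y \<le> (\<Sum>i<k. 32 * (alpha n s i)\<^sup>2 + 32 * (ln (real n) / real n)\<^sup>2)"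
      unfolding gamma_def by (intro sum_mono) auto
    also have "\<dots> = 32 * gamma n k s + real k * (32 * (ln (real n) / real n)\<^sup>2)"
      by (simp add: sum.distrib gamma_def sum_distrib_left)
    also have "\<dots> \<le> 32 * gamma n k s + real n * (32 * (ln (real n) / real n)\<^sup>2)"
      using assms(1) by (intro add_left_mono mult_right_mono) auto
    also have "\<dots> = 32 * gamma n k s + 32 * (ln (real n))\<^sup>2 / real n"
      using assms(2) by (simp add: power2_eq_square)
    finally show False using big by simp
  qed
  then have "measure_pmf.prob ?P {y. gamma n k y > 32 * gamma n k s + 32 * (ln (real n))\<^sup>2 / real n}
      \<le> measure_pmf.prob ?P (\<Union>i<k. ?B i)"
    by (rule measure_pmf.finite_measure_mono) simp
  also have "\<dots> \<le> (\<Sum>i<k. measure_pmf.prob ?P (?B i))"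
    by (rule measure_pmf.finite_measure_subadditive_finite) auto
  also have "\<dots> \<le> (\<Sum>i<k. 1 / real n ^ 4)" by (rule sum_mono) (use B in auto)
  also have "\<dots> \<le> real n * (1 / real n ^ 4)" using assms(1) by (simp add: divide_right_mono)
  also have "\<dots> = 1 / real n ^ 3" using assms(2) by (simp add: eval_nat_numeral)
  finally show ?thesis .
qed

section \<open>Law of a single vertex after one round\<close>

lemma expectation_unif_vertex:
  assumes "\<forall>v<n. s v < k" "n > 0"
  shows "measure_pmf.expectation (unif_vertex n) (\<lambda>w. h (s w)) = (\<Sum>i<k. alpha n s i * h i)"
proof -
  have "{..<n} \<noteq> {}" using assms(2) by auto
  then have "measure_pmf.expectation (unif_vertex n) (\<lambda>w. h (s w)) = (\<Sum>w<n. h (s w)) / real n"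
    unfolding unif_vertex_def by (subst integral_pmf_of_set) auto
  then show ?thesis using sum_over_vertices[OF assms] assms(2) by simp
qed

text \<open>With probability \<open>\<gamma>\<close> the first two samples agree, and with probability \<open>\<alpha> i\<^sup>2\<close> they agree on \<open>i\<close>.\<close>

lemma sum_alpha_agree:
  assumes "\<forall>v<n. s v < k" "n > 0" "i < k"
  shows "(\<Sum>a<k. alpha n s a * (\<Sum>b<k. alpha n s b * (if a = b then of_bool (a = i) else t)))
    = (alpha n s i)\<^sup>2 + (1 - gamma n k s) * t"
proof -
  let ?a = "alpha n s"
  \<comment> \<open>For a fixed first opinion \<open>a\<close>, the value \<open>t\<close> is
    counted for every second opinion and then corrected at \<open>b = a\<close>.\<close>
  have inner: "(\<Sum>b<k. ?a b * (if a = b then of_bool (a = i) else t)) = t + ?a a * (of_bool (a = i) - t)"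
    if "a < k" for a
  proof -
    have "(\<Sum>b<k. ?a b * (if a = b then of_bool (a = i) else t))
      = (\<Sum>b<k. t * ?a b + (if a = b then ?a a * (of_bool (a = i) - t) else 0))"
      by (intro sum.cong) (auto simp: algebra_simps)
    also have "\<dots> = t + ?a a * (of_bool (a = i) - t)"
      using that sum_alpha_eq_1[OF assms(1,2)]
      by (simp add: sum.distrib flip: sum_distrib_left)
    finally show ?thesis .
  qed
  have "(\<Sum>a<k. ?a a * (\<Sum>b<k. ?a b * (if a = b then of_bool (a = i) else t)))
    = (\<Sum>a<k. ?a a * (t + ?a a * (of_bool (a = i) - t)))"
    using inner by (intro sum.cong refl) simp
  also have "\<dots> = (\<Sum>a<k. t * ?a a + (if a = i then (?a i)\<^sup>2 else 0) - t * (?a a)\<^sup>2)"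
    by (intro sum.cong refl) (simp add: algebra_simps power2_eq_square)
  also have "\<dots> = t + (?a i)\<^sup>2 - t * gamma n k s"
    using assms(3) sum_alpha_eq_1[OF assms(1,2)]
    by (simp add: sum.distrib sum_subtractf gamma_def flip: sum_distrib_left)
  finally show ?thesis by (simp add: algebra_simps)
qed

text \<open>On disagreement the third sample has opinion \<open>i\<close> with probability
  \<open>alpha n s i\<close>, which is the value \<open>t\<close> in
  \<open>sum_alpha_agree\<close>.\<close>

lemma pmf_three_majority_vertex:
  assumes "\<forall>v<n. s v < k" "n > 0" "i < k"
  shows "pmf (three_majority_vertex n s v) i = alpha n s i * (1 + alpha n s i - gamma n k s)"
proof -
  let ?E = "measure_pmf.expectation (unif_vertex n)" and ?a = "alpha n s"
  note unif = expectation_unif_vertex[OF assms(1,2)]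
  have "pmf (three_majority_vertex n s v) i
    = ?E (\<lambda>w1. ?E (\<lambda>w2. ?E (\<lambda>w3. of_bool ((if s w1 = s w2 then s w1 else s w3) = i))))"
    unfolding three_majority_vertex_def pmf_bind pmf_return by (simp add: indicator_def of_bool_def)
  also have "\<dots> = (\<Sum>a<k. ?a a * (\<Sum>b<k. ?a b * (\<Sum>c<k. ?a c * of_bool ((if a = b then a else c) = i))))"
    \<comment> \<open>The instances of \<open>h\<close>, with holes for the outer samples, turn the
      expectations into sums from the innermost sample outwards.\<close>
    by (simp only: unif[where h = "\<lambda>c. of_bool ((if _ = _ then _ else c) = i)"]
        unif[where h = "\<lambda>b. \<Sum>c<k. ?a c * of_bool ((if _ = b then _ else c) = i)"]
        unif[where h = "\<lambda>a. \<Sum>b<k. ?a b * (\<Sum>c<k. ?a c * of_bool ((if a = b then a else c) = i))"])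
  also have "\<dots> = (\<Sum>a<k. ?a a * (\<Sum>b<k. ?a b * (if a = b then of_bool (a = i) else ?a i)))"
  proof -
    have "(\<Sum>c<k. ?a c * of_bool ((if a = b then a else c) = i)) =
        (if a = b then of_bool (a = i) else ?a i)" for a b
      using assms(3) sum_alpha_eq_1[OF assms(1,2)] by (auto simp: of_bool_def if_distrib cong: if_cong)
    then show ?thesis by simp
  qed
  also have "\<dots> = ?a i * (1 + ?a i - gamma n k s)"
    unfolding sum_alpha_agree[OF assms] by (simp add: algebra_simps power2_eq_square)
  finally show ?thesis .
qed

text \<open>On disagreement the vertex keeps its own opinion, so here \<open>t\<close> in
  \<open>sum_alpha_agree\<close> is \<open>of_bool (s v = i)\<close>.\<close>

lemma pmf_two_choices_vertex:
  assumes "\<forall>v<n. s v < k" "n > 0" "i < k"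
  shows "pmf (two_choices_vertex n s v) i = (alpha n s i)\<^sup>2 + (1 - gamma n k s) * of_bool (s v = i)"
proof -
  let ?E = "measure_pmf.expectation (unif_vertex n)" and ?a = "alpha n s"
  note unif = expectation_unif_vertex[OF assms(1,2)]
  have "pmf (two_choices_vertex n s v) i
    = ?E (\<lambda>w1. ?E (\<lambda>w2. if s w1 = s w2 then of_bool (s w1 = i) else of_bool (s v = i)))"
    unfolding two_choices_vertex_def pmf_bind pmf_return
    by (intro Bochner_Integration.integral_cong refl) (simp add: indicator_def of_bool_def)
  also have "\<dots> = (\<Sum>a<k. ?a a * (\<Sum>b<k. ?a b * (if a = b then of_bool (a = i) else of_bool (s v = i))))"
    by (simp only: unif[where h = "\<lambda>b. if _ = b then _ else _"]
        unif[where h = "\<lambda>a. \<Sum>b<k. ?a b * (if a = b then of_bool (a = i) else of_bool (s v = i))"])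
  finally show ?thesis unfolding sum_alpha_agree[OF assms] .
qed

section \<open>Invariance of the range of opinions\<close>

lemma set_pmf_unif_vertex: "n > 0 \<Longrightarrow> set_pmf (unif_vertex n) = {..<n}"
  unfolding unif_vertex_def by (intro set_pmf_of_set) auto

lemma three_majority_step_opinions:
  assumes "\<forall>v<n. s v < k" "y \<in> set_pmf (three_majority_step n s)" "v < n"
  shows "y v < k"
proof -
  have "y v \<in> set_pmf (three_majority_vertex n s v)"
    using assms(2,3) by (auto simp: three_majority_step_def set_Pi_pmf PiE_dflt_def)
  then show ?thesis
    using assms(1,3) by (auto simp: three_majority_vertex_def set_pmf_unif_vertex split: if_splits)
qed

lemma two_choices_step_opinions:
  assumes "\<forall>v<n. s v < k" "y \<in> set_pmf (two_choices_step n s)" "v < n"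
  shows "y v < k"
proof -
  have "y v \<in> set_pmf (two_choices_vertex n s v)"
    using assms(2,3) by (auto simp: two_choices_step_def set_Pi_pmf PiE_dflt_def)
  then show ?thesis
    using assms(1,3) by (auto simp: two_choices_vertex_def set_pmf_unif_vertex split: if_splits)
qed

section \<open>Mean counts and drift of the two processes\<close>

lemma sum_pmf_three_majority_vertex:
  assumes "\<forall>v<n. s v < k" "n > 0" "i < k"
  shows "(\<Sum>v<n. pmf (three_majority_vertex n s v) i)
    = real n * (alpha n s i * (1 + alpha n s i - gamma n k s))"
  by (simp add: pmf_three_majority_vertex[OF assms])

text \<open>The law depends on the vertex, but a fraction \<open>alpha n s i\<close> of the vertices
  holds \<open>i\<close>; averaging restores the mean of 3-Majority.\<close>

lemma sum_pmf_two_choices_vertex: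
  assumes "\<forall>v<n. s v < k" "n > 0" "i < k"
  shows "(\<Sum>v<n. pmf (two_choices_vertex n s v) i)
    = real n * (alpha n s i * (1 + alpha n s i - gamma n k s))"
proof -
  have "(\<Sum>v<n. of_bool (s v = i)) = real n * alpha n s i"
    using sum_over_vertices[OF assms(1,2), where h = "\<lambda>a. of_bool (a = i)"] assms(3)
    by (simp add: of_bool_def if_distrib cong: if_cong)
  then show ?thesis
    unfolding pmf_two_choices_vertex[OF assms] sum.distrib sum_distrib_left[symmetric]
    by (simp add: algebra_simps power2_eq_square)
qed

text \<open>The bound 1/16 on \<open>gamma\<close> forces fractions at most 1/4 and hence
  \<open>?p i\<close> at most 1/2, so each vertex has variance at least \<open>?p i / 2\<close>. As
  the \<open>?p i\<close> sum to 1, the total is at least \<open>n / 2\<close>, to be divided by the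
  square of \<open>n\<close>.\<close>

lemma three_majority_drift:
  assumes "\<forall>v<n. s v < k" "n > 0" "gamma n k s \<le> 1 / 16"
  shows "gamma n k s + 1 / (2 * real n) \<le> measure_pmf.expectation (three_majority_step n s) (gamma n k)"
proof -
  let ?a = "alpha n s" and ?g = "gamma n k s"
  let ?p = "\<lambda>i. ?a i * (1 + ?a i - ?g)"
  have "real n * ?p i / 2 \<le> (\<Sum>v<n. pmf (three_majority_vertex n s v) i * (1 - pmf (three_majority_vertex n s v) i))"
    if "i < k" for i
  proof -
    have "(?a i)\<^sup>2 \<le> (1 / 4)\<^sup>2"
      using alpha_square_le_gamma[OF that, of n s] assms(3) by (simp add: power2_eq_square)
    then have a: "?a i \<le> 1 / 4" by (rule power2_le_imp_le) simp
    have "?p i \<le> (1 / 4) * 2"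
      using a gamma_nonneg[of n k s] gamma_le_1[of n k s] alpha_nonneg[of n s i]
      by (intro mult_mono) auto
    moreover have "?p i \<ge> 0"
      using gamma_le_1[of n k s] alpha_nonneg[of n s i] by (intro mult_nonneg_nonneg) auto
    ultimately have "?p i * (1 / 2) \<le> ?p i * (1 - ?p i)" by (intro mult_left_mono) auto
    then have "real n * (?p i * (1 / 2)) \<le> real n * (?p i * (1 - ?p i))"
      by (rule mult_left_mono) simp
    then show ?thesis by (simp add: pmf_three_majority_vertex[OF assms(1,2) that])
  qed
  then have "?g + (\<Sum>i<k. real n * ?p i / 2) / (real n)\<^sup>2
    \<le> measure_pmf.expectation (three_majority_step n s) (gamma n k)"
    unfolding three_majority_step_def
    by (intro expectation_gamma_Pi_pmf sum_pmf_three_majority_vertex assms)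
  moreover have "(\<Sum>i<k. ?p i) = 1"
  proof -
    have "(\<Sum>i<k. ?p i) = (\<Sum>i<k. ?a i + (?a i)\<^sup>2 - ?g * ?a i)"
      by (intro sum.cong) (auto simp: algebra_simps power2_eq_square)
    then show ?thesis
      using sum_alpha_eq_1[OF assms(1,2)]
      by (simp add: sum.distrib sum_subtractf gamma_def[symmetric] flip: sum_distrib_left)
  qed
  then have "(\<Sum>i<k. real n * ?p i / 2) = real n / 2"
    by (simp flip: sum_distrib_left sum_divide_distrib)
  ultimately show ?thesis using assms(2) by (simp add: power2_eq_square)
qed

text \<open>Only vertices not holding \<open>i\<close> are counted: they adopt \<open>i\<close> with
  probability \<open>(?a i)\<^sup>2\<close>, and there are \<open>n * (1 - ?a i)\<close> of them.
  The total variance is then at least \<open>n * ?g / 2\<close>, hence at least 1/2.\<close>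

lemma two_choices_drift:
  assumes "\<forall>v<n. s v < k" "n > 0" "gamma n k s \<le> 1 / 16"
  shows "gamma n k s + 1 / (2 * (real n)\<^sup>2) \<le> measure_pmf.expectation (two_choices_step n s) (gamma n k)"
proof -
  let ?a = "alpha n s" and ?g = "gamma n k s"
  have "real n * (?a i)\<^sup>2 / 2 \<le> (\<Sum>v<n. pmf (two_choices_vertex n s v) i * (1 - pmf (two_choices_vertex n s v) i))"
    if "i < k" for i
  proof -
    have a16: "(?a i)\<^sup>2 \<le> 1 / 16"
      using alpha_square_le_gamma[OF that, of n s] assms(3) by simp
    then have "(?a i)\<^sup>2 \<le> (1 / 4)\<^sup>2" by (simp add: power2_eq_square)
    then have a: "?a i \<le> 1 / 4" by (rule power2_le_imp_le) simp
    have "1 / 2 \<le> (3 / 4) * (15 / 16 :: real)" by simp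
    also have "\<dots> \<le> (1 - ?a i) * (1 - (?a i)\<^sup>2)" using a a16 by (intro mult_mono) auto
    finally have "real n * ((?a i)\<^sup>2 * (1 / 2)) \<le> real n * ((?a i)\<^sup>2 * ((1 - ?a i) * (1 - (?a i)\<^sup>2)))"
      by (intro mult_left_mono) auto
    also have "\<dots> = (\<Sum>v<n. of_bool (s v \<noteq> i) * ((?a i)\<^sup>2 * (1 - (?a i)\<^sup>2)))"
    proof -
      have "(\<Sum>j<k. ?a j * of_bool (j \<noteq> i)) = (\<Sum>j<k. ?a j - (if j = i then ?a i else 0))"
        by (intro sum.cong) auto
      then have "(\<Sum>j<k. ?a j * of_bool (j \<noteq> i)) = 1 - ?a i"
        using sum_alpha_eq_1[OF assms(1,2)] that by (simp add: sum_subtractf)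
      then have "(\<Sum>v<n. of_bool (s v \<noteq> i)) = real n * (1 - ?a i)"
        using sum_over_vertices[OF assms(1,2), where h = "\<lambda>a. of_bool (a \<noteq> i)"] by simp
      then show ?thesis by (simp flip: sum_distrib_right)
    qed
    also have "\<dots> \<le> (\<Sum>v<n. pmf (two_choices_vertex n s v) i * (1 - pmf (two_choices_vertex n s v) i))"
    proof (rule sum_mono)
      fix v
      show "of_bool (s v \<noteq> i) * ((?a i)\<^sup>2 * (1 - (?a i)\<^sup>2))
        \<le> pmf (two_choices_vertex n s v) i * (1 - pmf (two_choices_vertex n s v) i)"
      proof (cases "s v = i")
        case True
        then show ?thesis by (simp add: pmf_le_1)
      next
        case False
        then show ?thesis by (simp add: pmf_two_choices_vertex[OF assms(1,2) that])
      qed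
    qed
    finally show ?thesis by simp
  qed
  then have "?g + (\<Sum>i<k. real n * (?a i)\<^sup>2 / 2) / (real n)\<^sup>2
    \<le> measure_pmf.expectation (two_choices_step n s) (gamma n k)"
    unfolding two_choices_step_def
    by (intro expectation_gamma_Pi_pmf sum_pmf_two_choices_vertex assms)
  moreover have "(\<Sum>i<k. real n * (?a i)\<^sup>2 / 2) = real n * ?g / 2"
    by (simp add: gamma_def flip: sum_distrib_left sum_divide_distrib)
  moreover have "real n * ?g \<ge> 1"
    using gamma_ge_inverse[OF assms(1,2)] assms(2) by (simp add: field_simps)
  then have "1 / (2 * (real n)\<^sup>2) \<le> real n * ?g / 2 / (real n)\<^sup>2"
    using assms(2) by (simp add: divide_right_mono)
  ultimately show ?thesis by simp
qed

section \<open>Reaching a level of \<open>gamma\<close> with high probability\<close>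

text \<open>About \<open>ln n\<close> blocks, each failing with probability at most 1/2, bring the
  failure probability below n to the power -1/2.\<close>

lemma prob_hits_gamma:
  assumes inv: "\<And>s y v. (\<forall>v<n. s v < k) \<Longrightarrow> y \<in> set_pmf (step s) \<Longrightarrow> v < n \<Longrightarrow> y v < k"
    and drift: "\<And>s. (\<forall>v<n. s v < k) \<Longrightarrow> gamma n k s \<le> 1 / 16 \<Longrightarrow>
      gamma n k s + d \<le> measure_pmf.expectation (step s) (gamma n k)"
    and jump: "\<And>s. (\<forall>v<n. s v < k) \<Longrightarrow> measure_pmf.prob (step s)
      {y. gamma n k y > 32 * gamma n k s + 32 * (ln (real n))\<^sup>2 / real n} \<le> 1 / real n ^ 3"
    and d: "d > 0" "1 / real n ^ 3 \<le> d / 2" and n: "n > 0" and x: "0 \<le> x" "x \<le> 1 / 16"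
    and time: "(ln (real n) + 1) * (4 * (32 * x + 32 * (ln (real n))\<^sup>2 / real n) / d + 2) \<le> t"
    and s: "\<forall>v<n. s v < k"
  shows "measure_pmf.prob (trajectory step s (nat \<lfloor>t\<rfloor>)) {xs. \<exists>T<length xs. gamma n k (xs ! T) \<ge> x}
    \<ge> 1 - real n powr (-(1/2))"
proof -
  define M where "M = 32 * x + 32 * (ln (real n))\<^sup>2 / real n"
  have M: "M \<ge> 0" using x by (simp add: M_def)
  \<comment> \<open>Floor plus 1 makes \<open>m\<close> strictly exceed \<open>4 * M / d\<close>;
    the summands 1 and 2 in \<open>time\<close> absorb the rounding of \<open>j\<close> and
    \<open>m\<close>.\<close>
  define m j where "m = nat (\<lfloor>4 * M / d\<rfloor> + 1)" and "j = nat \<lceil>ln (real n)\<rceil>"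
  have md: "0 \<le> 4 * M / d" using M d by simp
  have m: "4 * M / d < real m" "real m \<le> 4 * M / d + 2"
    using md by (simp_all add: m_def) linarith+
  have ln0: "ln (real n) \<ge> 0" using n by simp
  have j: "ln (real n) \<le> real j" "real j \<le> ln (real n) + 1"
    using ln0 by (simp_all add: j_def)
  have "real (j * m) \<le> (ln (real n) + 1) * (4 * M / d + 2)"
    unfolding of_nat_mult using j m ln0 by (intro mult_mono) auto
  then have "j * m \<le> nat \<lfloor>t\<rfloor>" using time unfolding M_def[symmetric] by (simp add: le_nat_floor)
  then have "measure_pmf.prob (trajectory step s (nat \<lfloor>t\<rfloor>)) {xs. \<exists>T<length xs. gamma n k (xs ! T) \<ge> x}
    \<ge> 1 - (1 / 2) ^ j"
  proof (intro prob_trajectory_hits[where V = "{s. \<forall>v<n. s v < k}" and d = d and M = M and m = m])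
    fix s
    assume V: "s \<in> {s. \<forall>v<n. s v < k}" and lt: "gamma n k s < x"
    show "gamma n k s + d \<le> measure_pmf.expectation (step s) (gamma n k)"
      using V lt x by (intro drift) auto
    \<comment> \<open>\<open>M\<close> is the jump threshold at level \<open>x\<close>, so below
      that level exceeding \<open>M\<close> is the rarer event.\<close>
    have "measure_pmf.prob (step s) {y. gamma n k y > M} \<le> measure_pmf.prob (step s)
      {y. gamma n k y > 32 * gamma n k s + 32 * (ln (real n))\<^sup>2 / real n}"
      using lt by (intro measure_pmf.finite_measure_mono) (auto simp: M_def)
    also have "\<dots> \<le> 1 / real n ^ 3" using V by (intro jump) auto
    finally show "measure_pmf.prob (step s) {y. gamma n k y > M} \<le> d / 2" using d(2) by simp
  qed (use inv d M m s in \<open>auto simp: gamma_nonneg gamma_le_1\<close>)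
  moreover have "(1 / 2 :: real) ^ j \<le> real n powr (-(1/2))"
  proof -
    \<comment> \<open>The root of e is at most 2, so j halvings beat exp(-j/2), where
      \<open>j\<close> is at least \<open>ln n\<close>.\<close>
    have "exp (1 / 2 :: real) \<le> 2"
    proof (rule power2_le_imp_le)
      have "(exp (1 / 2 :: real))\<^sup>2 = exp 1" by (simp flip: exp_of_nat_mult)
      then show "(exp (1 / 2 :: real))\<^sup>2 \<le> 2\<^sup>2" using exp_le by simp
    qed simp
    then have "exp (real j / 2) \<le> 2 ^ j"
      using power_mono[of "exp (1 / 2 :: real)" 2 j] by (simp flip: exp_of_nat_mult)
    moreover have "exp (ln (real n) / 2) \<le> exp (real j / 2)" using j by simp
    ultimately have "exp (ln (real n) / 2) \<le> 2 ^ j" by linarith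
    then have "inverse (2 ^ j) \<le> inverse (exp (ln (real n) / 2))"
      by (intro le_imp_inverse_le) auto
    then show ?thesis using n by (simp add: powr_def exp_minus power_one_over inverse_eq_divide)
  qed
  ultimately show ?thesis by simp
qed

text \<open>Below the threshold \<open>N\<close>, uniform in \<open>k\<close> and \<open>s\<close>,
  the claim is made vacuous by a \<open>D\<close> of at least the root of \<open>N\<close>: the
  asserted lower bound is then at most 0.\<close>

lemma high_probability_of_eventually:
  assumes "eventually (\<lambda>n. \<forall>k s. 1 \<le> k \<and> k \<le> n \<and> (\<forall>v<n. s v < k) \<longrightarrow>
    Q n k s \<ge> 1 - real n powr (-(1/2))) sequentially"
    and "\<And>n k s. Q n k s \<ge> 0"
  shows "\<exists>c>0. \<exists>D>0. \<forall>n k s. 1 \<le> k \<and> k \<le> n \<and> (\<forall>v<n. s v < k) \<longrightarrow> Q n k s \<ge> 1 - D * real n powr (-c)"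
proof -
  obtain N where N: "\<And>n k s. n \<ge> N \<Longrightarrow> 1 \<le> k \<and> k \<le> n \<and> (\<forall>v<n. s v < k) \<Longrightarrow>
    Q n k s \<ge> 1 - real n powr (-(1/2))"
    using assms(1) unfolding eventually_sequentially by blast
  define D where "D = max 1 (real N powr (1/2))"
  have "Q n k s \<ge> 1 - D * real n powr (-(1/2))"
    if nks: "1 \<le> k \<and> k \<le> n \<and> (\<forall>v<n. s v < k)" for n k s
  proof (cases "n \<ge> N")
    case True
    have "1 * real n powr (-(1/2)) \<le> D * real n powr (-(1/2))"
      by (intro mult_right_mono) (auto simp: D_def)
    then show ?thesis using N[OF True nks] by simp
  next
    case False
    have "1 = real n powr (1/2) * real n powr (-(1/2))"
      using nks by (simp flip: powr_add)
    also have "\<dots> \<le> D * real n powr (-(1/2))"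
      using False by (intro mult_right_mono) (auto simp: D_def intro!: max.coboundedI2 powr_mono2)
    finally show ?thesis using assms(2)[of n k s] by linarith
  qed
  moreover have "D > 0" by (simp add: D_def)
  ultimately show ?thesis by (intro exI[of _ "1/2"] exI[of _ D] conjI) auto
qed

section \<open>Choice of constants for both processes\<close>

theorem theorem2p2:
  fixes cstar :: real
  assumes "cstar > 0"
  shows "(\<exists>C>0. \<exists>c>0. \<exists>D>0. \<forall>n k opn0. 1 \<le> k \<and> k \<le> n \<and> (\<forall>v<n. opn0 v < k) \<longrightarrow>
            measure_pmf.prob
              (trajectory (three_majority_step n) opn0 (nat \<lfloor>C * sqrt (real n) * (ln (real n))^2\<rfloor>))
              {xs. \<exists>T<length xs. gamma n k (xs ! T) \<ge> cstar * ln (real n) / sqrt (real n)}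
            \<ge> 1 - D * real n powr (-c))
       \<and> (\<exists>C>0. \<exists>c>0. \<exists>D>0. \<forall>n k opn0. 1 \<le> k \<and> k \<le> n \<and> (\<forall>v<n. opn0 v < k) \<longrightarrow>
            measure_pmf.prob
              (trajectory (two_choices_step n) opn0 (nat \<lfloor>C * real n * (ln (real n))^3\<rfloor>))
              {xs. \<exists>T<length xs. gamma n k (xs ! T) \<ge> cstar * (ln (real n))^2 / real n}
            \<ge> 1 - D * real n powr (-c))"
proof (intro conjI)
  \<comment> \<open>The leading term of the time is \<open>ln n\<close> times 4 * 32 *
    \<open>cstar * ln n / sqrt n\<close>, divided by \<open>d = 1 / (2 * n)\<close>, which gives the
    factor \<open>256 * cstar\<close>. The added 1 absorbs lower orders, among them the
    \<open>(ln n)\<^sup>2 / n\<close> part of the jump threshold.\<close>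
  define C where "C = 256 * cstar + 1"
  have "eventually (\<lambda>n. cstar * ln (real n) / sqrt (real n) \<le> 1 / 16) sequentially"
    using assms by real_asymp
  moreover have "eventually (\<lambda>n. (ln (real n) + 1) * (4 * (32 * (cstar * ln (real n) / sqrt (real n))
      + 32 * (ln (real n))\<^sup>2 / real n) / (1 / (2 * real n)) + 2)
      \<le> C * sqrt (real n) * (ln (real n))^2) sequentially"
    unfolding C_def using assms by real_asymp
  moreover have "eventually (\<lambda>n. 1 / real n ^ 3 \<le> 1 / (2 * real n) / 2) sequentially"
    by real_asymp
  moreover have "eventually (\<lambda>n. n > (0 :: nat)) sequentially"
    by (rule eventually_gt_at_top)
  ultimately have "eventually (\<lambda>n. \<forall>k s. 1 \<le> k \<and> k \<le> n \<and> (\<forall>v<n. s v < k) \<longrightarrow>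
    measure_pmf.prob
      (trajectory (three_majority_step n) s (nat \<lfloor>C * sqrt (real n) * (ln (real n))^2\<rfloor>))
      {xs. \<exists>T<length xs. gamma n k (xs ! T) \<ge> cstar * ln (real n) / sqrt (real n)}
    \<ge> 1 - real n powr (-(1/2))) sequentially"
  proof eventually_elim
    case (elim n)
    show ?case
    proof (intro allI impI, elim conjE)
      fix k s
      assume k: "1 \<le> k" "k \<le> n" and s: "\<forall>v<n. s v < k"
      show "measure_pmf.prob
        (trajectory (three_majority_step n) s (nat \<lfloor>C * sqrt (real n) * (ln (real n))^2\<rfloor>))
        {xs. \<exists>T<length xs. gamma n k (xs ! T) \<ge> cstar * ln (real n) / sqrt (real n)}
        \<ge> 1 - real n powr (-(1/2))"
      proof (rule prob_hits_gamma[where d = "1 / (2 * real n)"])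
        show "gamma n k s + 1 / (2 * real n) \<le> measure_pmf.expectation (three_majority_step n s) (gamma n k)"
          if "\<forall>v<n. s v < k" "gamma n k s \<le> 1 / 16" for s
          by (rule three_majority_drift) (use that elim in auto)
        show "measure_pmf.prob (three_majority_step n s)
          {y. gamma n k y > 32 * gamma n k s + 32 * (ln (real n))\<^sup>2 / real n} \<le> 1 / real n ^ 3"
          if "\<forall>v<n. s v < k" for s
          unfolding three_majority_step_def
          by (intro prob_gamma_jump_Pi_pmf sum_pmf_three_majority_vertex) (use that k elim in auto)
      qed (use elim s assms in \<open>auto intro: three_majority_step_opinions\<close>)
    qed
  qed
  from high_probability_of_eventually[OF this]
  show "\<exists>C>0. \<exists>c>0. \<exists>D>0. \<forall>n k opn0. 1 \<le> k \<and> k \<le> n \<and> (\<forall>v<n. opn0 v < k) \<longrightarrow>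
            measure_pmf.prob
              (trajectory (three_majority_step n) opn0 (nat \<lfloor>C * sqrt (real n) * (ln (real n))^2\<rfloor>))
              {xs. \<exists>T<length xs. gamma n k (xs ! T) \<ge> cstar * ln (real n) / sqrt (real n)}
            \<ge> 1 - D * real n powr (-c)"
    using assms by (intro exI[of _ C]) (auto simp: C_def)
next
  \<comment> \<open>Here both parts of the jump threshold have order
    \<open>(ln n)\<^sup>2 / n\<close>, with weights \<open>cstar\<close> and 1, and dividing by
    \<open>d\<close> multiplies by twice the square of \<open>n\<close>.\<close>
  define C where "C = 256 * (cstar + 1) + 1"
  have "eventually (\<lambda>n. cstar * (ln (real n))^2 / real n \<le> 1 / 16) sequentially"
    using assms by real_asymp
  moreover have "eventually (\<lambda>n. (ln (real n) + 1) * (4 * (32 * (cstar * (ln (real n))^2 / real n)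
      + 32 * (ln (real n))\<^sup>2 / real n) / (1 / (2 * (real n)\<^sup>2)) + 2)
      \<le> C * real n * (ln (real n))^3) sequentially"
    unfolding C_def using assms by real_asymp
  moreover have "eventually (\<lambda>n. 1 / real n ^ 3 \<le> 1 / (2 * (real n)\<^sup>2) / 2) sequentially"
    by real_asymp
  moreover have "eventually (\<lambda>n. n > (0 :: nat)) sequentially"
    by (rule eventually_gt_at_top)
  ultimately have "eventually (\<lambda>n. \<forall>k s. 1 \<le> k \<and> k \<le> n \<and> (\<forall>v<n. s v < k) \<longrightarrow>
    measure_pmf.prob
      (trajectory (two_choices_step n) s (nat \<lfloor>C * real n * (ln (real n))^3\<rfloor>))
      {xs. \<exists>T<length xs. gamma n k (xs ! T) \<ge> cstar * (ln (real n))^2 / real n}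
    \<ge> 1 - real n powr (-(1/2))) sequentially"
  proof eventually_elim
    case (elim n)
    show ?case
    proof (intro allI impI, elim conjE)
      fix k s
      assume k: "1 \<le> k" "k \<le> n" and s: "\<forall>v<n. s v < k"
      show "measure_pmf.prob
        (trajectory (two_choices_step n) s (nat \<lfloor>C * real n * (ln (real n))^3\<rfloor>))
        {xs. \<exists>T<length xs. gamma n k (xs ! T) \<ge> cstar * (ln (real n))^2 / real n}
        \<ge> 1 - real n powr (-(1/2))"
      proof (rule prob_hits_gamma[where d = "1 / (2 * (real n)\<^sup>2)"])
        show "gamma n k s + 1 / (2 * (real n)\<^sup>2) \<le> measure_pmf.expectation (two_choices_step n s) (gamma n k)"
          if "\<forall>v<n. s v < k" "gamma n k s \<le> 1 / 16" for s
          by (rule two_choices_drift) (use that elim in auto)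
        show "measure_pmf.prob (two_choices_step n s)
          {y. gamma n k y > 32 * gamma n k s + 32 * (ln (real n))\<^sup>2 / real n} \<le> 1 / real n ^ 3"
          if "\<forall>v<n. s v < k" for s
          unfolding two_choices_step_def
          by (intro prob_gamma_jump_Pi_pmf sum_pmf_two_choices_vertex) (use that k elim in auto)
      qed (use elim s assms in \<open>auto intro: two_choices_step_opinions\<close>)
    qed
  qed
  from high_probability_of_eventually[OF this]
  show "\<exists>C>0. \<exists>c>0. \<exists>D>0. \<forall>n k opn0. 1 \<le> k \<and> k \<le> n \<and> (\<forall>v<n. opn0 v < k) \<longrightarrow>
            measure_pmf.prob
              (trajectory (two_choices_step n) opn0 (nat \<lfloor>C * real n * (ln (real n))^3\<rfloor>))
              {xs. \<exists>T<length xs. gamma n k (xs ! T) \<ge> cstar * (ln (real n))^2 / real n}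
            \<ge> 1 - D * real n powr (-c)"
    using assms by (intro exI[of _ C]) (auto simp: C_def)
qed

end
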